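(* Let $g\in\mathcal{B}$. Then $C_\varphi J_g-J_gC_\varphi:H^\infty(\mathbb{D})\to\mathcal{B}$ is compact for every $\varphi\in S(\mathbb{D})$ if and only if $g\in\mathcal{B}_0$.
   Context: $\mathbb{D}$ is the open unit disk in $\mathbb{C}$, $H(\mathbb{D})$ is the set of holomorphic functions on $\mathbb{D}$, $H^\infty(\mathbb{D})$ the bounded ones with the supremum norm, and $S(\mathbb{D})$ is the set of holomorphic maps $\mathbb{D}\to\mathbb{D}$. For $\varphi\in S(\mathbb{D})$, $C_\varphi f=f\circ\varphi$. For $g,f\in H(\mathbb{D})$, $J_gf(z)=\int_0^z f(\zeta)g'(\zeta)\,d\zeta$. The Bloch space $\mathcal{B}$ is the set of $f\in H(\mathbb{D})$ with $\|f\|_*=\sup_{z\in\mathbb{D}}(1-|z|^2)|f'(z)|<\infty$, a Banach space with norm $|f(0)|+\|f\|_*$. The little Bloch space $\mathcal{B}_0$ is the set of $f\in\mathcal{B}$ with $\lim_{|z|\to1}(1-|z|^2)|f'(z)|=0$. (The operator $J_g:H^\infty(\mathbb{D})\to\mathcal{B}$ is bounded exactly when $g\in\mathcal{B}$.) *)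

theory Defs
  imports "HOL-Complex_Analysis.Complex_Analysis"
begin

abbreviation unit_disk :: "complex set" ("\<bbbD>")
  where "\<bbbD> \<equiv> ball 0 1"

(* A function on the disk is represented by the total function that is undefined off the disk
   (extensional), so that equality in HOL is equality on the disk and the norms below separate
   points. *)
definition Hol :: "(complex \<Rightarrow> complex) set"
  where "Hol = {f \<in> extensional \<bbbD>. f holomorphic_on \<bbbD>}"

definition self_maps :: "(complex \<Rightarrow> complex) set"
  where "self_maps = {\<phi> \<in> Hol. \<phi> ` \<bbbD> \<subseteq> \<bbbD>}"

definition Hinf :: "(complex \<Rightarrow> complex) set"
  where "Hinf = {f \<in> Hol. bounded (f ` \<bbbD>)}"

definition Hinf_norm :: "(complex \<Rightarrow> complex) \<Rightarrow> real"
  where "Hinf_norm f = (SUP z\<in>\<bbbD>. cmod (f z))"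

definition bloch_weight :: "(complex \<Rightarrow> complex) \<Rightarrow> complex \<Rightarrow> real"
  where "bloch_weight f z = (1 - (cmod z)\<^sup>2) * cmod (deriv f z)"

definition Bloch :: "(complex \<Rightarrow> complex) set"
  where "Bloch = {f \<in> Hol. bdd_above (bloch_weight f ` \<bbbD>)}"

definition bloch_seminorm :: "(complex \<Rightarrow> complex) \<Rightarrow> real"
  where "bloch_seminorm f = (SUP z\<in>\<bbbD>. bloch_weight f z)"

definition bloch_norm :: "(complex \<Rightarrow> complex) \<Rightarrow> real"
  where "bloch_norm f = cmod (f 0) + bloch_seminorm f"

(* The filter expresses cmod z tending to 1 from below, uniformly in the argument of z. *)
definition little_Bloch :: "(complex \<Rightarrow> complex) set"
  where "little_Bloch =
    {f \<in> Bloch. (bloch_weight f \<longlongrightarrow> 0) (filtercomap cmod (at_left 1))}"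

(* The norms only see values on the disk, so the differences need not be restricted to it.
   Metric_space asks for nonnegativity off the carrier as well, hence the default value 0. *)
definition Hinf_dist :: "(complex \<Rightarrow> complex) \<Rightarrow> (complex \<Rightarrow> complex) \<Rightarrow> real"
  where "Hinf_dist f h =
    (if f \<in> Hinf \<and> h \<in> Hinf then Hinf_norm (\<lambda>z. f z - h z) else 0)"

definition Bloch_dist :: "(complex \<Rightarrow> complex) \<Rightarrow> (complex \<Rightarrow> complex) \<Rightarrow> real"
  where "Bloch_dist f h =
    (if f \<in> Bloch \<and> h \<in> Bloch then bloch_norm (\<lambda>z. f z - h z) else 0)"

definition Hinf_metric :: "(complex \<Rightarrow> complex) metric"
  where "Hinf_metric = metric (Hinf, Hinf_dist)"

definition Bloch_metric :: "(complex \<Rightarrow> complex) metric"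
  where "Bloch_metric = metric (Bloch, Bloch_dist)"

definition comp_op :: "(complex \<Rightarrow> complex) \<Rightarrow> (complex \<Rightarrow> complex) \<Rightarrow> complex \<Rightarrow> complex"
  where "comp_op \<phi> f = (\<lambda>z\<in>\<bbbD>. f (\<phi> z))"

definition J_op :: "(complex \<Rightarrow> complex) \<Rightarrow> (complex \<Rightarrow> complex) \<Rightarrow> complex \<Rightarrow> complex"
  where "J_op g f = (\<lambda>z\<in>\<bbbD>. contour_integral (linepath 0 z) (\<lambda>\<zeta>. f \<zeta> * deriv g \<zeta>))"

definition commutator_op ::
    "(complex \<Rightarrow> complex) \<Rightarrow> (complex \<Rightarrow> complex) \<Rightarrow> (complex \<Rightarrow> complex) \<Rightarrow> complex \<Rightarrow> complex"
  where "commutator_op \<phi> g f =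
    (\<lambda>z\<in>\<bbbD>. comp_op \<phi> (J_op g f) z - J_op g (comp_op \<phi> f) z)"

(* Bounded sets have relatively compact images. Only applied below to a linear map between
   normed spaces. The first conjunct matters: closure_of ignores points outside the carrier
   of the target. *)
definition compact_operator :: "'a metric \<Rightarrow> 'b metric \<Rightarrow> ('a \<Rightarrow> 'b) \<Rightarrow> bool"
  where "compact_operator X Y T \<longleftrightarrow>
    T \<in> mspace X \<rightarrow> mspace Y \<and>
    (\<forall>B. Metric_space.mbounded (mspace X) (mdist X) B \<longrightarrow>
       compactin (mtopology_of Y) (mtopology_of Y closure_of (T ` B)))"

lemma Hinf_bdd:
  assumes "f \<in> Hinf" "h \<in> Hinf"
  shows "bdd_above ((\<lambda>z. cmod (f z - h z)) ` \<bbbD>)"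
proof -
  obtain a b where "\<forall>z\<in>\<bbbD>. cmod (f z) \<le> a" "\<forall>z\<in>\<bbbD>. cmod (h z) \<le> b"
    using assms unfolding Hinf_def bounded_iff by blast
  then have "cmod (f z - h z) \<le> a + b" if "z \<in> \<bbbD>" for z
    using that norm_triangle_le_diff[of "f z" "h z" "a + b"] by fastforce
  then show ?thesis by (rule bdd_aboveI2)
qed

lemma Hinf_dist_upper:
  assumes "f \<in> Hinf" "h \<in> Hinf" "z \<in> \<bbbD>"
  shows "cmod (f z - h z) \<le> Hinf_dist f h"
  using cSUP_upper[OF assms(3) Hinf_bdd[OF assms(1,2)]] assms
  by (simp add: Hinf_dist_def Hinf_norm_def)

lemma Hinf_dist_least:
  assumes "f \<in> Hinf" "h \<in> Hinf" "\<And>z. z \<in> \<bbbD> \<Longrightarrow> cmod (f z - h z) \<le> c"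
  shows "Hinf_dist f h \<le> c"
proof -
  have "(SUP z\<in>\<bbbD>. cmod (f z - h z)) \<le> c"
    by (rule cSUP_least) (use assms(3) in auto)
  then show ?thesis using assms(1,2) by (simp add: Hinf_dist_def Hinf_norm_def)
qed

lemma Hol_eqI:
  assumes "f \<in> Hol" "h \<in> Hol" "\<And>z. z \<in> \<bbbD> \<Longrightarrow> f z = h z"
  shows "f = h"
  by (rule extensionalityI[of _ \<bbbD>]) (use assms in \<open>auto simp: Hol_def\<close>)

lemma Metric_space_Hinf: "Metric_space Hinf Hinf_dist"
proof
  show "0 \<le> Hinf_dist f h" for f h
  proof (cases "f \<in> Hinf \<and> h \<in> Hinf")
    case True
    then show ?thesis
      using order_trans[OF norm_ge_zero Hinf_dist_upper[of f h 0]] by simp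
  qed (auto simp: Hinf_dist_def)
  show "Hinf_dist f h = Hinf_dist h f" for f h
    by (auto simp: Hinf_dist_def Hinf_norm_def norm_minus_commute)
  show "Hinf_dist f h = 0 \<longleftrightarrow> f = h" if "f \<in> Hinf" "h \<in> Hinf" for f h
  proof
    assume "Hinf_dist f h = 0"
    then have "f z = h z" if "z \<in> \<bbbD>" for z
      using Hinf_dist_upper[OF \<open>f \<in> Hinf\<close> \<open>h \<in> Hinf\<close> that] by simp
    then show "f = h" using that by (intro Hol_eqI) (auto simp: Hinf_def)
  qed (simp add: Hinf_dist_def Hinf_norm_def)
  show "Hinf_dist f k \<le> Hinf_dist f h + Hinf_dist h k"
    if "f \<in> Hinf" "h \<in> Hinf" "k \<in> Hinf" for f h k
  proof (rule Hinf_dist_least[OF that(1,3)])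
    fix z :: complex assume z: "z \<in> \<bbbD>"
    have "cmod (f z - k z) \<le> cmod (f z - h z) + cmod (h z - k z)"
      using norm_triangle_ineq[of "f z - h z" "h z - k z"] by simp
    then show "cmod (f z - k z) \<le> Hinf_dist f h + Hinf_dist h k"
      using Hinf_dist_upper[OF that(1,2) z] Hinf_dist_upper[OF that(2,3) z] by linarith
  qed
qed

lemma bloch_weight_nonneg: "z \<in> \<bbbD> \<Longrightarrow> 0 \<le> bloch_weight f z"
  by (simp add: bloch_weight_def power_le_one)

lemma Hol_diff_deriv:
  assumes "f \<in> Hol" "h \<in> Hol" "z \<in> \<bbbD>"
  shows "deriv (\<lambda>w. f w - h w) z = deriv f z - deriv h z"
  using assms by (intro deriv_diff holomorphic_on_imp_differentiable_at[of _ \<bbbD>])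
    (auto simp: Hol_def)

lemma bloch_weight_diff:
  assumes "f \<in> Hol" "h \<in> Hol" "z \<in> \<bbbD>"
  shows "bloch_weight (\<lambda>w. f w - h w) z = (1 - (cmod z)\<^sup>2) * cmod (deriv f z - deriv h z)"
  using assms by (simp add: bloch_weight_def Hol_diff_deriv)

lemma bloch_weight_triangle:
  assumes "f \<in> Hol" "h \<in> Hol" "k \<in> Hol" "z \<in> \<bbbD>"
  shows "bloch_weight (\<lambda>w. f w - k w) z
    \<le> bloch_weight (\<lambda>w. f w - h w) z + bloch_weight (\<lambda>w. h w - k w) z"
proof -
  have "cmod (deriv f z - deriv k z)
      \<le> cmod (deriv f z - deriv h z) + cmod (deriv h z - deriv k z)"
    using norm_triangle_ineq[of "deriv f z - deriv h z" "deriv h z - deriv k z"] by simp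
  moreover have "0 \<le> 1 - (cmod z)\<^sup>2"
    using assms by (simp add: power_le_one)
  ultimately show ?thesis
    using assms by (simp add: bloch_weight_diff mult_left_mono flip: distrib_left)
qed

lemma Bloch_bdd:
  assumes "f \<in> Bloch" "h \<in> Bloch"
  shows "bdd_above (bloch_weight (\<lambda>z. f z - h z) ` \<bbbD>)"
proof -
  have Hol: "f \<in> Hol" "h \<in> Hol" using assms by (auto simp: Bloch_def)
  obtain a b where ab: "\<And>z. z \<in> \<bbbD> \<Longrightarrow> bloch_weight f z \<le> a"
      "\<And>z. z \<in> \<bbbD> \<Longrightarrow> bloch_weight h z \<le> b"
    using assms unfolding Bloch_def bdd_above_def by blast
  have "bloch_weight (\<lambda>z. f z - h z) z \<le> a + b" if z: "z \<in> \<bbbD>" for z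
  proof -
    have "0 \<le> 1 - (cmod z)\<^sup>2"
      using z by (simp add: power_le_one)
    then have "bloch_weight (\<lambda>z. f z - h z) z \<le> bloch_weight f z + bloch_weight h z"
      using mult_left_mono[OF norm_triangle_ineq4[of "deriv f z" "deriv h z"]]
      by (subst bloch_weight_diff[OF Hol z]) (simp add: bloch_weight_def flip: distrib_left)
    then show ?thesis using ab[OF z] by linarith
  qed
  then show ?thesis by (rule bdd_aboveI2)
qed

lemma bloch_seminorm_upper:
  assumes "f \<in> Bloch" "h \<in> Bloch" "z \<in> \<bbbD>"
  shows "bloch_weight (\<lambda>z. f z - h z) z \<le> bloch_seminorm (\<lambda>z. f z - h z)"
  unfolding bloch_seminorm_def by (rule cSUP_upper[OF assms(3) Bloch_bdd[OF assms(1,2)]])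

lemma bloch_seminorm_nonneg:
  assumes "f \<in> Bloch" "h \<in> Bloch"
  shows "0 \<le> bloch_seminorm (\<lambda>z. f z - h z)"
proof -
  have "(0::complex) \<in> \<bbbD>" by simp
  from bloch_seminorm_upper[OF assms this] bloch_weight_nonneg[OF this] show ?thesis
    by (rule order_trans[rotated])
qed

lemma Metric_space_Bloch: "Metric_space Bloch Bloch_dist"
proof
  show "0 \<le> Bloch_dist f h" for f h
    by (auto simp: Bloch_dist_def bloch_norm_def intro!: add_nonneg_nonneg bloch_seminorm_nonneg)
  show "Bloch_dist f h = Bloch_dist h f" for f h
  proof (cases "f \<in> Bloch \<and> h \<in> Bloch")
    case True
    then have "f \<in> Hol" "h \<in> Hol" by (auto simp: Bloch_def)
    then have "bloch_seminorm (\<lambda>z. f z - h z) = bloch_seminorm (\<lambda>z. h z - f z)"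
      unfolding bloch_seminorm_def
      by (intro SUP_cong) (auto simp: bloch_weight_diff norm_minus_commute)
    then show ?thesis
      by (auto simp: Bloch_dist_def bloch_norm_def norm_minus_commute)
  qed (auto simp: Bloch_dist_def)
  show "Bloch_dist f h = 0 \<longleftrightarrow> f = h" if fh: "f \<in> Bloch" "h \<in> Bloch" for f h
  proof
    have Hol: "f \<in> Hol" "h \<in> Hol" using fh by (auto simp: Bloch_def)
    assume "Bloch_dist f h = 0"
    then have "cmod (f 0 - h 0) + bloch_seminorm (\<lambda>z. f z - h z) = 0"
      using fh by (simp add: Bloch_dist_def bloch_norm_def)
    then have zero: "f 0 - h 0 = 0" "bloch_seminorm (\<lambda>z. f z - h z) = 0"
      using bloch_seminorm_nonneg[OF fh] norm_ge_zero[of "f 0 - h 0"]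
      by (auto simp: add_nonneg_eq_0_iff)
    have "deriv (\<lambda>z. f z - h z) z = 0" if z: "z \<in> \<bbbD>" for z
    proof -
      have "bloch_weight (\<lambda>z. f z - h z) z = 0"
        using bloch_seminorm_upper[OF fh z] bloch_weight_nonneg[OF z] zero(2)
        by (metis order_antisym)
      moreover have "(cmod z)\<^sup>2 \<noteq> 1"
        using z abs_square_less_1[of "cmod z"] by simp
      ultimately show ?thesis by (simp add: bloch_weight_def)
    qed
    moreover have "(\<lambda>z. f z - h z) holomorphic_on \<bbbD>"
      using Hol by (auto simp: Hol_def intro: holomorphic_on_diff)
    ultimately have "((\<lambda>z. f z - h z) has_field_derivative 0) (at z)" if "z \<in> \<bbbD>" for z
      using holomorphic_derivI[OF _ open_ball that] that by metis
    then have "\<exists>c. \<forall>z\<in>\<bbbD>. f z - h z = c"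
      by (intro has_field_derivative_zero_constant)
        (auto intro: has_field_derivative_at_within)
    then obtain c where c: "\<And>z. z \<in> \<bbbD> \<Longrightarrow> f z - h z = c" by blast
    have "c = 0" using c[of 0] zero(1) by simp
    with c have "f z = h z" if "z \<in> \<bbbD>" for z using that by fastforce
    with Hol show "f = h" by (rule Hol_eqI)
  next
    assume "f = h"
    then show "Bloch_dist f h = 0"
      by (simp add: Bloch_dist_def bloch_norm_def bloch_seminorm_def bloch_weight_def)
  qed
  show "Bloch_dist f k \<le> Bloch_dist f h + Bloch_dist h k"
    if B: "f \<in> Bloch" "h \<in> Bloch" "k \<in> Bloch" for f h k
  proof -
    have Hol: "f \<in> Hol" "h \<in> Hol" "k \<in> Hol" using B by (auto simp: Bloch_def)
    have "bloch_seminorm (\<lambda>z. f z - k z)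
        \<le> bloch_seminorm (\<lambda>z. f z - h z) + bloch_seminorm (\<lambda>z. h z - k z)"
      unfolding bloch_seminorm_def[of "\<lambda>z. f z - k z"]
    proof (rule cSUP_least)
      fix z :: complex assume z: "z \<in> \<bbbD>"
      show "bloch_weight (\<lambda>z. f z - k z) z
          \<le> bloch_seminorm (\<lambda>z. f z - h z) + bloch_seminorm (\<lambda>z. h z - k z)"
        using bloch_weight_triangle[OF Hol z] bloch_seminorm_upper[OF B(1,2) z]
          bloch_seminorm_upper[OF B(2,3) z] by linarith
    qed auto
    moreover have "cmod (f 0 - k 0) \<le> cmod (f 0 - h 0) + cmod (h 0 - k 0)"
      using norm_triangle_ineq[of "f 0 - h 0" "h 0 - k 0"] by simp
    ultimately show ?thesis
      using B by (simp add: Bloch_dist_def bloch_norm_def)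
  qed
qed

lemma
  shows mspace_Hinf_metric [simp]: "mspace Hinf_metric = Hinf"
    and mdist_Hinf_metric [simp]: "mdist Hinf_metric = Hinf_dist"
  by (simp_all add: Hinf_metric_def Metric_space.mspace_metric Metric_space.mdist_metric
      Metric_space_Hinf)

lemma
  shows mspace_Bloch_metric [simp]: "mspace Bloch_metric = Bloch"
    and mdist_Bloch_metric [simp]: "mdist Bloch_metric = Bloch_dist"
  by (simp_all add: Bloch_metric_def Metric_space.mspace_metric Metric_space.mdist_metric
      Metric_space_Bloch)

end

theory Submission
  imports Defs
begin

text \<open>Write \<open>T f\<close> for the image of \<open>f\<close> under the commutator. The derivatives of its two parts both contain
the factor \<open>f (\<phi> z)\<close>, so
\<open>(T f)' z = f (\<phi> z) * (\<phi>' z * g' (\<phi> z) - g' z) = f (\<phi> z) * (g \<circ> \<phi> - g)' z\<close>.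
Everything is read off this product (\<open>commutator_op_has_field_derivative\<close>).

If \<open>g\<close> is in the little Bloch space, \<open>T\<close> maps bounded sequences that converge locally uniformly to
sequences that converge in the Bloch norm (\<open>commutator_op_tendsto\<close>). By the Schwarz-Pick inequality
the weighted derivative of \<open>T f\<close> at \<open>z\<close> is at most \<open>cmod (f (\<phi> z))\<close> times the sum of the weights of
\<open>g\<close> at \<open>\<phi> z\<close> and at \<open>z\<close>. Each weight is small near the circle, and away from the circle \<open>f (\<phi> z)\<close> is
evaluated on a compact set. Montel's theorem extracts such a sequence from any bounded one, and \<open>T\<close> is
compact (\<open>compact_operator_commutator_op\<close>).

Conversely, rotations alone force \<open>g\<close> into the little Bloch space. Compactness is tested on the powers
\<open>z ^ n\<close>: they are bounded, their images have derivatives tending to \<open>0\<close> pointwise, so along a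
subsequence their images tend to \<open>0\<close> in the Bloch seminorm. As \<open>cmod (\<phi> z) ^ n\<close> is close to \<open>1\<close> when
\<open>\<phi> z\<close> is close enough to the circle, the weighted derivative of \<open>g \<circ> \<phi> - g\<close> must be small there
(\<open>compact_commutator_op_imp_weight_decay\<close>). For \<open>\<phi> z = cis t * z\<close> this says that
\<open>(1 - (cmod z)\<^sup>2) * cmod (cis t * g' (cis t * z) - g' z)\<close> tends to \<open>0\<close> at the circle, for every \<open>t\<close>.
Now average over \<open>t\<close>. The mean of \<open>cis t * g' (cis t * z)\<close> is \<open>0\<close>, because up to a constant it is
the derivative of the periodic function \<open>g (cis t * z)\<close> of \<open>t\<close>; the integrands are dominated by twice the Bloch
seminorm. What remains in the limit is that \<open>(1 - (cmod z)\<^sup>2) * cmod (g' z)\<close> tends to \<open>0\<close>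
(\<open>little_Bloch_if_rotation_decay\<close>).\<close>

section \<open>The Schwarz-Pick inequality\<close>

lemma one_minus_norm_square_pos: "cmod z < 1 \<Longrightarrow> 0 < 1 - (cmod z)\<^sup>2"
  by (simp add: power_less_one_iff abs_square_less_1)

lemma of_real_one_minus_norm_square: "of_real (1 - (cmod z)\<^sup>2) = 1 - cnj z * z"
  by (simp only: of_real_diff of_real_1 complex_norm_square mult.commute)

lemma Moebius_function_has_derivative_at_0:
  "(Moebius_function 0 (- a) has_field_derivative of_real (1 - (cmod a)\<^sup>2)) (at 0)"
  unfolding Moebius_function_simple of_real_one_minus_norm_square
  by (rule derivative_eq_intros refl | simp)+

lemma Moebius_function_has_derivative_at_centre:
  assumes "cmod b < 1"
  shows "(Moebius_function 0 b has_field_derivative 1 / of_real (1 - (cmod b)\<^sup>2)) (at b)"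
proof -
  have nz: "1 - cnj b * b \<noteq> 0"
    using one_minus_norm_square_pos[OF assms]
    by (metis of_real_one_minus_norm_square of_real_eq_0_iff less_irrefl)
  show ?thesis
    unfolding Moebius_function_simple of_real_one_minus_norm_square
    by (rule derivative_eq_intros refl nz | simp add: nz)+
qed

lemma self_mapsD:
  assumes "\<phi> \<in> self_maps"
  shows "\<phi> holomorphic_on \<bbbD>" and "z \<in> \<bbbD> \<Longrightarrow> \<phi> z \<in> \<bbbD>"
  using assms by (auto simp: self_maps_def Hol_def image_subset_iff)

text \<open>The Schwarz lemma, transported by disk automorphisms. It is what makes composition with a self-map
bounded for the Bloch seminorm.\<close>

lemma Schwarz_Pick:
  assumes \<phi>: "\<phi> \<in> self_maps" and a: "a \<in> \<bbbD>"
  shows "(1 - (cmod a)\<^sup>2) * cmod (deriv \<phi> a) \<le> 1 - (cmod (\<phi> a))\<^sup>2"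
proof -
  have hol: "\<phi> holomorphic_on \<bbbD>" and maps: "\<And>z. cmod z < 1 \<Longrightarrow> cmod (\<phi> z) < 1"
    using \<phi> by (auto simp: self_maps_def Hol_def image_subset_iff)
  have a1: "cmod a < 1" and b1: "cmod (\<phi> a) < 1"
    using a maps by auto
  have M0: "Moebius_function 0 (- a) 0 = a"
    by (simp add: Moebius_function_simple)
  \<comment> \<open>Moving \<open>a\<close> and \<open>\<phi> a\<close> to the origin makes the Schwarz lemma applicable; the derivative of \<open>F\<close>
     at \<open>0\<close> is the hyperbolic derivative of \<open>\<phi>\<close> at \<open>a\<close>.\<close>
  define F where "F = (\<lambda>z. Moebius_function 0 (\<phi> a) (\<phi> (Moebius_function 0 (- a) z)))"
  have Fhol: "F holomorphic_on \<bbbD>"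
    unfolding F_def
    by (rule holomorphic_on_compose_gen[where t=\<bbbD>, unfolded o_def,
          OF _ Moebius_function_holomorphic[OF b1]]
        holomorphic_on_compose_gen[where t=\<bbbD>, unfolded o_def, OF _ hol]
        Moebius_function_holomorphic)+
      (use a1 in \<open>auto intro!: maps Moebius_function_norm_lt_1\<close>)
  have F0: "F 0 = 0"
    by (simp add: F_def M0 Moebius_function_eq_zero)
  have Fmaps: "cmod (F z) < 1" if "cmod z < 1" for z
    unfolding F_def using that a1 b1 by (auto intro!: Moebius_function_norm_lt_1 maps)
  have "(\<phi> has_field_derivative deriv \<phi> a) (at a)"
    using hol a by (intro holomorphic_derivI) auto
  then have "((\<lambda>z. \<phi> (Moebius_function 0 (- a) z)) has_field_derivative
      deriv \<phi> a * of_real (1 - (cmod a)\<^sup>2)) (at 0)"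
    by (intro DERIV_chain2[OF _ Moebius_function_has_derivative_at_0]) (simp add: M0)
  then have "(F has_field_derivative
      1 / of_real (1 - (cmod (\<phi> a))\<^sup>2) * (deriv \<phi> a * of_real (1 - (cmod a)\<^sup>2))) (at 0)"
    unfolding F_def
    by (intro DERIV_chain2[where f="Moebius_function 0 (\<phi> a)"])
      (simp_all add: M0 Moebius_function_has_derivative_at_centre[OF b1, simplified])
  then have "deriv F 0 = 1 / of_real (1 - (cmod (\<phi> a))\<^sup>2) * (deriv \<phi> a * of_real (1 - (cmod a)\<^sup>2))"
    by (rule DERIV_imp_deriv)
  then have "cmod (deriv F 0) = (1 - (cmod a)\<^sup>2) * cmod (deriv \<phi> a) / (1 - (cmod (\<phi> a))\<^sup>2)"
    using one_minus_norm_square_pos[OF a1] one_minus_norm_square_pos[OF b1]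
    by (simp only: norm_mult norm_divide norm_of_real norm_one abs_of_pos) simp
  moreover have "cmod (deriv F 0) \<le> 1"
    by (rule Schwarz_Lemma(2)[OF Fhol F0 Fmaps, of 0]) auto
  ultimately show ?thesis
    using one_minus_norm_square_pos[OF b1] by (simp add: divide_le_eq_1)
qed

section \<open>Bounded functions and Bloch functions\<close>

lemma HinfD:
  assumes "f \<in> Hinf"
  shows "f \<in> Hol" "f holomorphic_on \<bbbD>"
  using assms by (auto simp: Hinf_def Hol_def)

lemma BlochD:
  assumes "g \<in> Bloch"
  shows "g \<in> Hol" "g holomorphic_on \<bbbD>"
  using assms by (auto simp: Bloch_def Hol_def)

lemma BlochI:
  assumes "f \<in> Hol" "\<And>z. z \<in> \<bbbD> \<Longrightarrow> bloch_weight f z \<le> c"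
  shows "f \<in> Bloch"
  using assms bdd_aboveI2[of \<bbbD> "bloch_weight f" c] by (simp add: Bloch_def)

lemma Bloch_weight_bound:
  assumes "g \<in> Bloch"
  obtains G where "G > 0" "\<And>z. z \<in> \<bbbD> \<Longrightarrow> bloch_weight g z \<le> G"
proof -
  obtain G where "\<And>z. z \<in> \<bbbD> \<Longrightarrow> bloch_weight g z \<le> G"
    using assms unfolding Bloch_def bdd_above_def by blast
  then show ?thesis using that[of "max G 1"] by fastforce
qed

lemma Hinf_bound:
  assumes "f \<in> Hinf"
  obtains M where "M > 0" "\<And>z. z \<in> \<bbbD> \<Longrightarrow> cmod (f z) \<le> M"
  using assms unfolding Hinf_def by (auto simp: bounded_pos)

lemma Bloch_dist_upper:
  assumes "f \<in> Bloch" "h \<in> Bloch" "z \<in> \<bbbD>"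
  shows "bloch_weight (\<lambda>w. f w - h w) z \<le> Bloch_dist f h"
  using add_increasing[OF norm_ge_zero bloch_seminorm_upper[OF assms]] assms(1,2)
  by (simp add: Bloch_dist_def bloch_norm_def)

text \<open>Only the moduli matter for the filter, so the limit becomes smallness of the weight on an annulus.\<close>

lemma little_Bloch_iff:
  "g \<in> little_Bloch \<longleftrightarrow> g \<in> Bloch \<and>
    (\<forall>\<epsilon>>0. \<exists>\<rho><1. \<forall>z. \<rho> < cmod z \<and> cmod z < 1 \<longrightarrow> bloch_weight g z < \<epsilon>)"
proof -
  have "(\<forall>\<^sub>F z in filtercomap cmod (at_left 1). dist (bloch_weight g z) 0 < \<epsilon>)
      \<longleftrightarrow> (\<exists>\<rho><1. \<forall>z. \<rho> < cmod z \<and> cmod z < 1 \<longrightarrow> bloch_weight g z < \<epsilon>)" for \<epsilon>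
  proof -
    have abs: "cmod z < 1 \<Longrightarrow> \<bar>bloch_weight g z\<bar> = bloch_weight g z" for z
      using bloch_weight_nonneg[of z g] by simp
    have "(\<forall>\<^sub>F z in filtercomap cmod (at_left 1). dist (bloch_weight g z) 0 < \<epsilon>)
      \<longleftrightarrow> (\<exists>\<rho><1. \<forall>z. \<rho> < cmod z \<and> cmod z < 1 \<longrightarrow> \<bar>bloch_weight g z\<bar> < \<epsilon>)"
      unfolding eventually_filtercomap eventually_at_left[OF zero_less_one] dist_real_def
    proof safe
      fix P b assume "\<forall>z. P (cmod z) \<longrightarrow> \<bar>bloch_weight g z - 0\<bar> < \<epsilon>" "b < 1" "\<forall>y>b. y < 1 \<longrightarrow> P y"
      then show "\<exists>\<rho><1. \<forall>z. \<rho> < cmod z \<and> cmod z < 1 \<longrightarrow> \<bar>bloch_weight g z\<bar> < \<epsilon>"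
        by (intro exI[of _ b]) auto
    next
      fix \<rho> :: real assume "\<rho> < 1" "\<forall>z. \<rho> < cmod z \<and> cmod z < 1 \<longrightarrow> \<bar>bloch_weight g z\<bar> < \<epsilon>"
      then show "\<exists>P. (\<exists>b<1. \<forall>y>b. y < 1 \<longrightarrow> P y) \<and> (\<forall>z. P (cmod z) \<longrightarrow> \<bar>bloch_weight g z - 0\<bar> < \<epsilon>)"
        by (intro exI[of _ "\<lambda>y. \<rho> < y \<and> y < 1"]) auto
    qed
    then show ?thesis using abs by metis
  qed
  then show ?thesis
    by (simp add: little_Bloch_def tendsto_iff)
qed

section \<open>The derivative of the commutator\<close>

lemma J_op_0 [simp]: "J_op g f 0 = 0"
  by (simp add: J_op_def)

text \<open>On the convex disk the integrand has a holomorphic primitive, and \<open>J_op\<close> is that primitive up to a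
constant.\<close>

lemma J_op_has_field_derivative:
  assumes f: "f holomorphic_on \<bbbD>" and g: "g holomorphic_on \<bbbD>" and z: "z \<in> \<bbbD>"
  shows "(J_op g f has_field_derivative f z * deriv g z) (at z)"
proof -
  have "(\<lambda>\<zeta>. f \<zeta> * deriv g \<zeta>) holomorphic_on \<bbbD>"
    by (intro holomorphic_intros f g holomorphic_deriv) auto
  from holomorphic_convex_primitive'[OF convex_ball open_ball this]
  obtain F where F: "\<And>x. x \<in> \<bbbD> \<Longrightarrow>
      (F has_field_derivative f x * deriv g x) (at x within \<bbbD>)"
    by blast
  \<comment> \<open>Segments from the origin stay in the disk, so the integral is a difference of values of
     the primitive.\<close>
  have J: "J_op g f x = F x - F 0" if "x \<in> \<bbbD>" for x
  proof -
    have "path_image (linepath 0 x) \<subseteq> \<bbbD>"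
      using that by (simp add: closed_segment_subset)
    from contour_integral_primitive[OF F valid_path_linepath this] show ?thesis
      using that by (simp add: J_op_def contour_integral_unique)
  qed
  have "((\<lambda>x. F x - F 0) has_field_derivative f z * deriv g z) (at z)"
    using F[OF z] z by (auto simp: at_within_open[OF _ open_ball] intro!: derivative_eq_intros)
  then show ?thesis
    by (rule has_field_derivative_transform_within_open[OF _ open_ball z]) (use J in auto)
qed

lemma commutator_op_0: "\<phi> 0 \<in> \<bbbD> \<Longrightarrow> commutator_op \<phi> g f 0 = J_op g f (\<phi> 0)"
  by (simp add: commutator_op_def comp_op_def)

text \<open>The chain rule on the first part and \<open>J_op_has_field_derivative\<close> on the second leave the common
factor \<open>f (\<phi> z)\<close>.\<close>

lemma commutator_op_has_field_derivative:
  assumes \<phi>: "\<phi> \<in> self_maps" and f: "f holomorphic_on \<bbbD>" and g: "g holomorphic_on \<bbbD>"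
    and z: "z \<in> \<bbbD>"
  shows "(commutator_op \<phi> g f has_field_derivative
    f (\<phi> z) * (deriv \<phi> z * deriv g (\<phi> z) - deriv g z)) (at z)"
proof -
  note \<phi>D = self_mapsD[OF \<phi>]
  have "(\<phi> has_field_derivative deriv \<phi> z) (at z)"
    using \<phi>D(1) z by (intro holomorphic_derivI) auto
  then have 1: "((\<lambda>x. J_op g f (\<phi> x)) has_field_derivative
      f (\<phi> z) * deriv g (\<phi> z) * deriv \<phi> z) (at z)"
    by (rule DERIV_chain2[where f="J_op g f" and g=\<phi>, OF J_op_has_field_derivative[OF f g \<phi>D(2)[OF z]]])
  have "(\<lambda>x. f (\<phi> x)) holomorphic_on \<bbbD>"
    using holomorphic_on_compose_gen[OF \<phi>D(1) f] \<phi>D(2) by (simp add: o_def image_subset_iff)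
  then have "comp_op \<phi> f holomorphic_on \<bbbD>"
    by (rule holomorphic_transform) (simp add: comp_op_def)
  then have "(J_op g (comp_op \<phi> f) has_field_derivative f (\<phi> z) * deriv g z) (at z)"
    using J_op_has_field_derivative[OF _ g z, of "comp_op \<phi> f"] z by (simp add: comp_op_def)
  with 1 have "((\<lambda>x. J_op g f (\<phi> x) - J_op g (comp_op \<phi> f) x) has_field_derivative
      f (\<phi> z) * (deriv \<phi> z * deriv g (\<phi> z) - deriv g z)) (at z)"
    by (auto intro!: derivative_eq_intros simp: algebra_simps)
  then show ?thesis
    by (rule has_field_derivative_transform_within_open[OF _ open_ball z])
      (simp add: commutator_op_def comp_op_def)
qed

lemma commutator_op_in_Hol:
  assumes "\<phi> \<in> self_maps" "f holomorphic_on \<bbbD>" "g holomorphic_on \<bbbD>"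
  shows "commutator_op \<phi> g f \<in> Hol"
  unfolding Hol_def
proof (intro CollectI conjI)
  show "commutator_op \<phi> g f holomorphic_on \<bbbD>"
    using commutator_op_has_field_derivative[OF assms]
    by (metis holomorphic_on_open open_ball)
qed (simp add: commutator_op_def)

lemma bloch_weight_commutator_diff:
  assumes \<phi>: "\<phi> \<in> self_maps" and g: "g holomorphic_on \<bbbD>"
    and f: "f holomorphic_on \<bbbD>" and h: "h holomorphic_on \<bbbD>" and z: "z \<in> \<bbbD>"
  shows "bloch_weight (\<lambda>w. commutator_op \<phi> g f w - commutator_op \<phi> g h w) z
    = cmod (f (\<phi> z) - h (\<phi> z)) *
      ((1 - (cmod z)\<^sup>2) * cmod (deriv \<phi> z * deriv g (\<phi> z) - deriv g z))"
  using DERIV_imp_deriv[OF commutator_op_has_field_derivative[OF \<phi> f g z]]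
    DERIV_imp_deriv[OF commutator_op_has_field_derivative[OF \<phi> h g z]]
  by (simp add: bloch_weight_diff[OF commutator_op_in_Hol[OF \<phi> f g] commutator_op_in_Hol[OF \<phi> h g] z]
      norm_mult flip: left_diff_distrib)

text \<open>The Schwarz-Pick inequality trades the product of \<open>1 - (cmod z)\<^sup>2\<close> and \<open>cmod (deriv \<phi> z)\<close> for the
factor \<open>1 - (cmod (\<phi> z))\<^sup>2\<close> at the image point.\<close>

lemma commutator_weight_le:
  assumes "\<phi> \<in> self_maps" "z \<in> \<bbbD>"
  shows "(1 - (cmod z)\<^sup>2) * cmod (deriv \<phi> z * deriv g (\<phi> z) - deriv g z)
    \<le> bloch_weight g (\<phi> z) + bloch_weight g z"
proof -
  have pos: "0 \<le> 1 - (cmod z)\<^sup>2"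
    using assms by (simp add: power_le_one)
  have "(1 - (cmod z)\<^sup>2) * cmod (deriv \<phi> z * deriv g (\<phi> z) - deriv g z)
      \<le> (1 - (cmod z)\<^sup>2) * (cmod (deriv \<phi> z) * cmod (deriv g (\<phi> z)) + cmod (deriv g z))"
    using norm_triangle_ineq4[of "deriv \<phi> z * deriv g (\<phi> z)" "deriv g z"] pos
    by (intro mult_left_mono) (auto simp: norm_mult)
  also have "\<dots> = (1 - (cmod z)\<^sup>2) * cmod (deriv \<phi> z) * cmod (deriv g (\<phi> z)) + bloch_weight g z"
    by (simp add: bloch_weight_def algebra_simps)
  also have "\<dots> \<le> bloch_weight g (\<phi> z) + bloch_weight g z"
    using mult_right_mono[OF Schwarz_Pick[OF assms]] by (simp add: bloch_weight_def)
  finally show ?thesis .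
qed

lemma commutator_op_in_Bloch:
  assumes \<phi>: "\<phi> \<in> self_maps" and g: "g \<in> Bloch" and f: "f \<in> Hinf"
  shows "commutator_op \<phi> g f \<in> Bloch"
proof -
  obtain G where G: "G > 0" "\<And>z. z \<in> \<bbbD> \<Longrightarrow> bloch_weight g z \<le> G"
    using Bloch_weight_bound[OF g] by blast
  obtain M where M: "M > 0" "\<And>z. z \<in> \<bbbD> \<Longrightarrow> cmod (f z) \<le> M"
    using Hinf_bound[OF f] by blast
  show ?thesis
  proof (rule BlochI)
    show "commutator_op \<phi> g f \<in> Hol"
      using commutator_op_in_Hol[OF \<phi>] f g by (blast dest: HinfD BlochD)
    fix z :: complex assume z: "z \<in> \<bbbD>"
    note \<phi>z = self_mapsD(2)[OF \<phi> z]
    have "bloch_weight (commutator_op \<phi> g f) z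
        = cmod (f (\<phi> z)) * ((1 - (cmod z)\<^sup>2) * cmod (deriv \<phi> z * deriv g (\<phi> z) - deriv g z))"
      using DERIV_imp_deriv[OF commutator_op_has_field_derivative[OF \<phi> HinfD(2)[OF f] BlochD(2)[OF g] z]]
      by (simp add: bloch_weight_def norm_mult)
    also have "\<dots> \<le> M * (bloch_weight g (\<phi> z) + bloch_weight g z)"
      using commutator_weight_le[OF \<phi> z] M z \<phi>z by (intro mult_mono) (auto simp: power_le_one)
    also have "\<dots> \<le> M * (G + G)"
      using G(2)[OF z] G(2)[OF \<phi>z] M(1) by (intro mult_left_mono) auto
    finally show "bloch_weight (commutator_op \<phi> g f) z \<le> M * (G + G)" .
  qed
qed

section \<open>Compactness for symbols in the little Bloch space\<close>

text \<open>The value of the commutator at the origin is \<open>J_op g f (\<phi> 0)\<close>; this estimate controls that part of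
the Bloch norm.\<close>

lemma cmod_J_op_diff_le:
  assumes f: "f holomorphic_on \<bbbD>" and h: "h holomorphic_on \<bbbD>" and g: "g holomorphic_on \<bbbD>"
    and a: "a \<in> \<bbbD>"
    and le: "\<And>z. z \<in> closed_segment 0 a \<Longrightarrow> cmod (f z - h z) \<le> \<eta>"
      "\<And>z. z \<in> closed_segment 0 a \<Longrightarrow> cmod (deriv g z) \<le> C"
  shows "cmod (J_op g f a - J_op g h a) \<le> \<eta> * C"
proof -
  have \<eta>: "0 \<le> \<eta>" and C: "0 \<le> C"
    using order_trans[OF norm_ge_zero le(1)[of 0]] order_trans[OF norm_ge_zero le(2)[of 0]] by auto
  have seg: "z \<in> \<bbbD>" if "z \<in> closed_segment 0 a" for z
    using closed_segment_subset[of 0 \<bbbD> a] a that by auto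
  have "cmod ((J_op g f a - J_op g h a) - (J_op g f 0 - J_op g h 0)) \<le> \<eta> * C * cmod (a - 0)"
  proof (rule field_differentiable_bound[of "closed_segment 0 a"])
    fix z assume z: "z \<in> closed_segment 0 a"
    show "((\<lambda>z. J_op g f z - J_op g h z) has_field_derivative f z * deriv g z - h z * deriv g z)
        (at z within closed_segment 0 a)"
      using J_op_has_field_derivative[OF f g seg[OF z]] J_op_has_field_derivative[OF h g seg[OF z]]
      by (intro DERIV_diff) (auto intro: has_field_derivative_at_within)
    show "cmod (f z * deriv g z - h z * deriv g z) \<le> \<eta> * C"
      using le[OF z] \<eta> by (auto simp: norm_mult intro!: mult_mono simp flip: left_diff_distrib)
  qed auto
  also have "\<dots> \<le> \<eta> * C * 1"
    using a \<eta> C by (intro mult_left_mono) auto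
  finally show ?thesis by simp
qed

text \<open>The distance of \<open>f n\<close> and \<open>h\<close> enters as a factor of a weight of \<open>g\<close>, taken at \<open>z\<close> or at \<open>\<phi> z\<close>. Near the
circle the weight is small and the distance bounded; on a compact subset of the disk it is the other
way round.\<close>

lemma commutator_op_tendsto:
  assumes \<phi>: "\<phi> \<in> self_maps" and g: "g \<in> little_Bloch"
    and fn: "\<And>n. f n \<in> Hinf" and h: "h \<in> Hinf"
    and M: "\<And>n z. z \<in> \<bbbD> \<Longrightarrow> cmod (f n z) \<le> M" "\<And>z. z \<in> \<bbbD> \<Longrightarrow> cmod (h z) \<le> M"
    and lim: "\<And>K. compact K \<Longrightarrow> K \<subseteq> \<bbbD> \<Longrightarrow> uniform_limit K f h sequentially"
  shows "(\<lambda>n. Bloch_dist (commutator_op \<phi> g (f n)) (commutator_op \<phi> g h)) \<longlonglongrightarrow> 0"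
proof (rule tendstoI)
  fix \<epsilon> :: real assume \<epsilon>: "0 < \<epsilon>"
  have gB: "g \<in> Bloch"
    using g by (simp add: little_Bloch_def)
  note hol = HinfD(2)[OF fn] HinfD(2)[OF h] BlochD(2)[OF gB]
  have M0: "M \<ge> 0"
    using order_trans[OF norm_ge_zero M(2)[of 0]] by simp
  obtain G where G: "G > 0" "\<And>z. z \<in> \<bbbD> \<Longrightarrow> bloch_weight g z \<le> G"
    using Bloch_weight_bound[OF gB] by blast
  have "\<phi> 0 \<in> \<bbbD>"
    using self_mapsD(2)[OF \<phi>] by simp
  then have seg: "closed_segment 0 (\<phi> 0) \<subseteq> \<bbbD>"
    by (simp add: closed_segment_subset)
  have "continuous_on (closed_segment 0 (\<phi> 0)) (deriv g)"
    using hol(3) seg by (intro holomorphic_on_imp_continuous_on holomorphic_on_subset[OF _ seg]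
        holomorphic_deriv) auto
  then have "bounded (deriv g ` closed_segment 0 (\<phi> 0))"
    by (intro compact_imp_bounded compact_continuous_image) auto
  then obtain C where C: "C > 0" "\<And>z. z \<in> closed_segment 0 (\<phi> 0) \<Longrightarrow> cmod (deriv g z) \<le> C"
    unfolding bounded_pos by auto
  \<comment> \<open>The three error terms below are each at most \<open>\<epsilon> / 8\<close>: where the weight of \<open>g\<close> is less than \<open>\<delta>\<close>,
     the functions only have to be bounded by \<open>M\<close>, and elsewhere their distance is at most \<open>\<eta>\<close>.\<close>
  define \<delta> where "\<delta> = \<epsilon> / (16 * (M + 1))"
  define \<eta> where "\<eta> = \<epsilon> / (8 * (G + C))"
  have \<delta>: "\<delta> > 0" "2 * M * \<delta> \<le> \<epsilon> / 8"
    using \<epsilon> M0 by (auto simp: \<delta>_def field_simps)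
  have \<eta>: "\<eta> > 0" "\<eta> * G \<le> \<epsilon> / 8" "\<eta> * C \<le> \<epsilon> / 8"
    using \<epsilon> G(1) C(1) by (auto simp: \<eta>_def field_simps)
  obtain \<rho> where \<rho>: "\<rho> < 1" "\<And>z. \<rho> < cmod z \<Longrightarrow> cmod z < 1 \<Longrightarrow> bloch_weight g z < \<delta>"
    using g \<delta>(1) unfolding little_Bloch_iff by blast
  \<comment> \<open>The points where the difference of the functions must be small: \<open>z\<close> and \<open>\<phi> z\<close> for
     \<open>z\<close> in the inner disk, and the segment that determines the value at the origin.\<close>
  define K where "K = cball 0 \<rho> \<union> \<phi> ` cball 0 \<rho> \<union> closed_segment 0 (\<phi> 0)"
  have cball: "cball 0 \<rho> \<subseteq> \<bbbD>"
    using \<rho>(1) by auto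
  have "compact K"
    unfolding K_def
    by (intro compact_Un compact_continuous_image holomorphic_on_imp_continuous_on
        holomorphic_on_subset[OF self_mapsD(1)[OF \<phi>] cball]) auto
  moreover have "K \<subseteq> \<bbbD>"
    unfolding K_def using cball seg self_mapsD(2)[OF \<phi>] by blast
  ultimately have "uniform_limit K f h sequentially"
    by (rule lim)
  from uniform_limitD[OF this \<eta>(1)]
  show "\<forall>\<^sub>F n in sequentially.
      dist (Bloch_dist (commutator_op \<phi> g (f n)) (commutator_op \<phi> g h)) 0 < \<epsilon>"
  proof eventually_elim
    case (elim n)
    have small: "cmod (f n w - h w) \<le> \<eta>" if "w \<in> K" for w
      using elim that by (auto simp: dist_norm intro: less_imp_le)
    have product: "cmod (f n w - h w) * bloch_weight g z \<le> \<epsilon> / 8"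
      if w: "w \<in> \<bbbD>" and z: "z \<in> \<bbbD>" and K: "cmod z \<le> \<rho> \<Longrightarrow> w \<in> K" for w z
    proof (cases "cmod z \<le> \<rho>")
      case True
      then have "cmod (f n w - h w) * bloch_weight g z \<le> \<eta> * G"
        using small[OF K] G(2)[OF z] bloch_weight_nonneg[OF z] \<eta>(1) by (intro mult_mono) auto
      then show ?thesis using \<eta>(2) by linarith
    next
      case False
      have "cmod (f n w - h w) \<le> 2 * M"
        using norm_triangle_ineq4[of "f n w" "h w"] M(1)[OF w, of n] M(2)[OF w] by linarith
      then have "cmod (f n w - h w) * bloch_weight g z \<le> 2 * M * \<delta>"
        using \<rho>(2)[of z] False z bloch_weight_nonneg[OF z] M0 by (intro mult_mono) auto
      then show ?thesis using \<delta>(2) by linarith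
    qed
    have "bloch_seminorm (\<lambda>w. commutator_op \<phi> g (f n) w - commutator_op \<phi> g h w) \<le> \<epsilon> / 4"
      unfolding bloch_seminorm_def
    proof (rule cSUP_least)
      fix z :: complex assume z: "z \<in> \<bbbD>"
      note \<phi>z = self_mapsD(2)[OF \<phi> z]
      have "bloch_weight (\<lambda>w. commutator_op \<phi> g (f n) w - commutator_op \<phi> g h w) z
          \<le> cmod (f n (\<phi> z) - h (\<phi> z)) * (bloch_weight g (\<phi> z) + bloch_weight g z)"
        using commutator_weight_le[OF \<phi> z]
        by (simp add: bloch_weight_commutator_diff[OF \<phi> hol(3,1,2) z] mult_left_mono)
      also have "\<dots> = cmod (f n (\<phi> z) - h (\<phi> z)) * bloch_weight g (\<phi> z)
          + cmod (f n (\<phi> z) - h (\<phi> z)) * bloch_weight g z"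
        by (rule distrib_left)
      also have "\<dots> \<le> \<epsilon> / 8 + \<epsilon> / 8"
        by (intro add_mono product \<phi>z z) (auto simp: K_def)
      finally show "bloch_weight (\<lambda>w. commutator_op \<phi> g (f n) w - commutator_op \<phi> g h w) z \<le> \<epsilon> / 4"
        by simp
    qed auto
    moreover have "cmod (commutator_op \<phi> g (f n) 0 - commutator_op \<phi> g h 0) \<le> \<eta> * C"
      using cmod_J_op_diff_le[OF hol(1,2,3) \<open>\<phi> 0 \<in> \<bbbD>\<close> small C(2)] \<open>\<phi> 0 \<in> \<bbbD>\<close>
      by (simp add: commutator_op_0 K_def)
    ultimately have "bloch_norm (\<lambda>w. commutator_op \<phi> g (f n) w - commutator_op \<phi> g h w) < \<epsilon>"
      unfolding bloch_norm_def using \<eta>(3) \<epsilon> by linarith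
    then show ?case
      using commutator_op_in_Bloch[OF \<phi> gB] fn h
        Metric_space.nonneg[OF Metric_space_Bloch, of "commutator_op \<phi> g (f n)" "commutator_op \<phi> g h"]
      by (simp add: Bloch_dist_def)
  qed
qed

text \<open>Montel's theorem, with the limit made extensional and its bound preserved.\<close>

lemma Hinf_Montel:
  assumes f: "\<And>n. f n \<in> Hinf" and M: "\<And>n z. z \<in> \<bbbD> \<Longrightarrow> cmod (f n z) \<le> M"
  obtains h r where "h \<in> Hinf" "\<And>z. z \<in> \<bbbD> \<Longrightarrow> cmod (h z) \<le> M" "strict_mono (r :: nat \<Rightarrow> nat)"
    "\<And>K. compact K \<Longrightarrow> K \<subseteq> \<bbbD> \<Longrightarrow> uniform_limit K (\<lambda>n. f (r n)) h sequentially"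
proof -
  obtain k r where k: "k holomorphic_on \<bbbD>" and r: "strict_mono (r :: nat \<Rightarrow> nat)"
    and pt: "\<And>x. x \<in> \<bbbD> \<Longrightarrow> (\<lambda>n. f (r n) x) \<longlonglongrightarrow> k x"
    and unif: "\<And>K. compact K \<Longrightarrow> K \<subseteq> \<bbbD> \<Longrightarrow> uniform_limit K (f \<circ> r) k sequentially"
  proof (rule Montel[of \<bbbD> "range f" f])
    show "\<exists>B. \<forall>h\<in>range f. \<forall>z\<in>K. cmod (h z) \<le> B" if "K \<subseteq> \<bbbD>" for K
      using M that by blast
  qed (use f HinfD in auto)
  define h where "h = restrict k \<bbbD>"
  have hM: "cmod (h z) \<le> M" if "z \<in> \<bbbD>" for z
    using that M by (auto simp: h_def intro!: LIMSEQ_le_const2[OF tendsto_norm[OF pt]])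
  show ?thesis
  proof
    have "h holomorphic_on \<bbbD>"
      by (rule holomorphic_transform[OF k]) (simp add: h_def)
    then show "h \<in> Hinf"
      using hM unfolding Hinf_def Hol_def bounded_iff by (auto simp: h_def intro!: exI[of _ M])
    show "uniform_limit K (\<lambda>n. f (r n)) h sequentially" if K: "compact K" "K \<subseteq> \<bbbD>" for K
    proof -
      have "uniform_limit K (\<lambda>n. f (r n)) h sequentially \<longleftrightarrow> uniform_limit K (f \<circ> r) k sequentially"
        by (rule uniform_limit_cong') (use K(2) in \<open>auto simp: h_def\<close>)
      then show ?thesis using unif[OF K] by simp
    qed
  qed (use hM r in auto)
qed

text \<open>The limits are allowed to lie outside \<open>S\<close>, so the images of a bounded set can be treated without
describing their closure.\<close>

lemma (in Metric_space) compactin_closure_ofI_sequentially: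
  assumes "S \<subseteq> M"
    and "\<And>\<sigma> :: nat \<Rightarrow> 'a. range \<sigma> \<subseteq> S \<Longrightarrow>
      \<exists>l r. strict_mono r \<and> limitin mtopology (\<sigma> \<circ> r) l sequentially"
  shows "compactin mtopology (mtopology closure_of S)"
proof -
  have "\<forall>\<sigma> :: nat \<Rightarrow> 'a. range \<sigma> \<subseteq> S
      \<longrightarrow> (\<exists>l r. l \<in> M \<and> strict_mono r \<and> limitin mtopology (\<sigma> \<circ> r) l sequentially)"
    using assms(2) limitin_mspace by blast
  then have "\<forall>T. T \<subseteq> S \<and> infinite T \<longrightarrow> M \<inter> mtopology derived_set_of T \<noteq> {}"
    using Bolzano_Weierstrass_property[OF assms(1) assms(1)] by (rule iffD1[rotated])
  then show ?thesis
    unfolding compact_closure_of_eq_Bolzano_Weierstrass by blast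
qed

lemma Hinf_mbounded_bound:
  assumes "Metric_space.mbounded Hinf Hinf_dist B"
  obtains M where "\<And>f z. f \<in> B \<Longrightarrow> z \<in> \<bbbD> \<Longrightarrow> cmod (f z) \<le> M"
proof -
  interpret Metric_space Hinf Hinf_dist
    by (rule Metric_space_Hinf)
  obtain c b where B: "B \<subseteq> mcball c b"
    using assms unfolding mbounded_def by blast
  show ?thesis
  proof (cases "B = {}")
    case False
    then have c: "c \<in> Hinf"
      using B by auto
    obtain m where m: "\<And>z. z \<in> \<bbbD> \<Longrightarrow> cmod (c z) \<le> m"
      using Hinf_bound[OF c] by blast
    have "cmod (f z) \<le> m + b" if "f \<in> B" "z \<in> \<bbbD>" for f z
    proof -
      have "f \<in> Hinf" "Hinf_dist c f \<le> b"
        using B that by auto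
      then have "cmod (c z - f z) \<le> b"
        using Hinf_dist_upper[OF c, of f z] that by linarith
      then show ?thesis
        using m[OF that(2)] norm_triangle_ineq4[of "c z" "c z - f z"] by simp
    qed
    then show ?thesis by (rule that)
  qed (use that in auto)
qed

lemma compact_operator_commutator_op:
  assumes g: "g \<in> little_Bloch" and \<phi>: "\<phi> \<in> self_maps"
  shows "compact_operator Hinf_metric Bloch_metric (commutator_op \<phi> g)"
proof -
  interpret B: Metric_space Bloch Bloch_dist
    by (rule Metric_space_Bloch)
  have gB: "g \<in> Bloch"
    using g by (simp add: little_Bloch_def)
  note T = commutator_op_in_Bloch[OF \<phi> gB]
  have "compactin B.mtopology (B.mtopology closure_of (commutator_op \<phi> g ` A))"
    if A: "Metric_space.mbounded Hinf Hinf_dist A" for A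
  proof (rule B.compactin_closure_ofI_sequentially)
    have AH: "A \<subseteq> Hinf"
      using Metric_space.mbounded_subset_mspace[OF Metric_space_Hinf A] .
    then show "commutator_op \<phi> g ` A \<subseteq> Bloch"
      using T by auto
    fix \<sigma> :: "nat \<Rightarrow> complex \<Rightarrow> complex" assume "range \<sigma> \<subseteq> commutator_op \<phi> g ` A"
    then have "\<forall>n. \<exists>f\<in>A. \<sigma> n = commutator_op \<phi> g f"
      by blast
    then obtain f where f: "\<And>n. f n \<in> A" "\<And>n. \<sigma> n = commutator_op \<phi> g (f n)"
      by metis
    have fH: "f n \<in> Hinf" for n
      using f(1) AH by blast
    obtain M where M: "\<And>n z. z \<in> \<bbbD> \<Longrightarrow> cmod (f n z) \<le> M"
      using Hinf_mbounded_bound[OF A] f(1) by metis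
    obtain h r where h: "h \<in> Hinf" "\<And>z. z \<in> \<bbbD> \<Longrightarrow> cmod (h z) \<le> M" and r: "strict_mono r"
      and lim: "\<And>K. compact K \<Longrightarrow> K \<subseteq> \<bbbD> \<Longrightarrow> uniform_limit K (\<lambda>n. f (r n)) h sequentially"
      by (rule Hinf_Montel[of f M, OF fH M]) (assumption | rule that)+
    have "limitin B.mtopology (\<sigma> \<circ> r) (commutator_op \<phi> g h) sequentially"
      unfolding B.limitin_metric_dist_null
      using commutator_op_tendsto[OF \<phi> g fH h(1) M h(2) lim] T fH h(1) by (simp add: f(2))
    with r show "\<exists>l r. strict_mono r \<and> limitin B.mtopology (\<sigma> \<circ> r) l sequentially"
      by blast
  qed
  then show ?thesis
    using T by (auto simp: compact_operator_def mtopology_of_def)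
qed

section \<open>Decay forced by compactness\<close>

lemma power_in_Hinf: "restrict (\<lambda>z. z ^ n) \<bbbD> \<in> Hinf"
proof -
  have "restrict (\<lambda>z. z ^ n) \<bbbD> holomorphic_on \<bbbD>"
    by (rule holomorphic_transform[of "\<lambda>z. z ^ n"]) (auto intro!: holomorphic_intros)
  moreover have "bounded (restrict (\<lambda>z. z ^ n) \<bbbD> ` \<bbbD>)"
    by (auto simp: bounded_iff norm_power intro!: exI[of _ 1] power_le_one)
  ultimately show ?thesis
    by (simp add: Hinf_def Hol_def)
qed

lemma mbounded_powers:
  "Metric_space.mbounded Hinf Hinf_dist (range (\<lambda>n. restrict (\<lambda>z. z ^ n) \<bbbD>))"
  unfolding Metric_space.mbounded_alt[OF Metric_space_Hinf]
proof (intro conjI exI ballI)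
  show "range (\<lambda>n. restrict (\<lambda>z. z ^ n) \<bbbD>) \<subseteq> Hinf"
    using power_in_Hinf by blast
  fix f h :: "complex \<Rightarrow> complex"
  assume "f \<in> range (\<lambda>n. restrict (\<lambda>z. z ^ n) \<bbbD>)" "h \<in> range (\<lambda>n. restrict (\<lambda>z. z ^ n) \<bbbD>)"
  then obtain m n where eq: "f = restrict (\<lambda>z. z ^ m) \<bbbD>" "h = restrict (\<lambda>z. z ^ n) \<bbbD>"
    by blast
  show "Hinf_dist f h \<le> 2"
  proof (rule Hinf_dist_least)
    fix z :: complex assume z: "z \<in> \<bbbD>"
    have "cmod (z ^ m - z ^ n) \<le> cmod z ^ m + cmod z ^ n"
      using norm_triangle_ineq4[of "z ^ m" "z ^ n"] by (simp add: norm_power)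
    also have "\<dots> \<le> 1 + 1"
      using z by (intro add_mono power_le_one) auto
    finally show "cmod (f z - h z) \<le> 2"
      using z by (simp add: eq)
  qed (simp_all add: eq power_in_Hinf)
qed

text \<open>The powers \<open>z ^ n\<close> tend to \<open>0\<close> pointwise in the disk, while the modulus of each one tends to \<open>1\<close> at
the circle. Compactness makes the images of some of them small in the Bloch seminorm,
and a single such power already bounds the weighted derivative of \<open>g \<circ> \<phi> - g\<close> wherever \<open>\<phi> z\<close> is near
the circle.\<close>

lemma compact_commutator_op_imp_weight_decay:
  assumes g: "g \<in> Bloch" and \<phi>: "\<phi> \<in> self_maps"
    and cpt: "compact_operator Hinf_metric Bloch_metric (commutator_op \<phi> g)" and \<epsilon>: "0 < \<epsilon>"
  obtains \<rho> where "\<rho> < 1" "\<And>z. z \<in> \<bbbD> \<Longrightarrow> \<rho> < cmod (\<phi> z) \<Longrightarrow>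
    (1 - (cmod z)\<^sup>2) * cmod (deriv \<phi> z * deriv g (\<phi> z) - deriv g z) < \<epsilon>"
proof -
  interpret B: Metric_space Bloch Bloch_dist
    by (rule Metric_space_Bloch)
  define p where "p n = restrict (\<lambda>z::complex. z ^ n) \<bbbD>" for n :: nat
  define T where "T n = commutator_op \<phi> g (p n)" for n
  define w where "w z = (1 - (cmod z)\<^sup>2) * cmod (deriv \<phi> z * deriv g (\<phi> z) - deriv g z)" for z
  have p: "p n \<in> Hinf" for n
    unfolding p_def by (rule power_in_Hinf)
  have T: "T n \<in> Bloch" for n
    unfolding T_def by (rule commutator_op_in_Bloch[OF \<phi> g p])
  have dT: "deriv (T n) z = \<phi> z ^ n * (deriv \<phi> z * deriv g (\<phi> z) - deriv g z)" if z: "z \<in> \<bbbD>" for n z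
    using DERIV_imp_deriv[OF commutator_op_has_field_derivative[OF \<phi> HinfD(2)[OF p] BlochD(2)[OF g] z]]
      self_mapsD(2)[OF \<phi> z] by (simp add: T_def p_def)
  have "compactin B.mtopology (B.mtopology closure_of (commutator_op \<phi> g ` range p))"
    using cpt mbounded_powers by (simp add: compact_operator_def mtopology_of_def p_def)
  moreover have "range T \<subseteq> B.mtopology closure_of (commutator_op \<phi> g ` range p)"
    using closure_of_subset[of "range T" B.mtopology] T by (auto simp: T_def image_image)
  ultimately obtain l r where r: "strict_mono (r :: nat \<Rightarrow> nat)"
    and l: "limitin B.mtopology (T \<circ> r) l sequentially"
    unfolding B.compactin_sequentially by blast
  then have lB: "l \<in> Bloch" and lim: "(\<lambda>n. Bloch_dist (T (r n)) l) \<longlonglongrightarrow> 0"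
    by (auto simp: B.limitin_metric_dist_null)
  have dist: "(1 - (cmod z)\<^sup>2) * cmod (deriv (T n) z - deriv l z) \<le> Bloch_dist (T n) l"
    if "z \<in> \<bbbD>" for n z
    using Bloch_dist_upper[OF T lB that, of n] bloch_weight_diff[OF BlochD(1)[OF T] BlochD(1)[OF lB] that]
    by simp
  \<comment> \<open>The limit is a constant function, since the derivatives \<open>\<phi> z ^ r n * _\<close> tend to \<open>0\<close>
     pointwise.\<close>
  have dl: "deriv l z = 0" if z: "z \<in> \<bbbD>" for z
  proof -
    have "(\<lambda>n. (1 - (cmod z)\<^sup>2) * cmod (deriv (T (r n)) z - deriv l z)) \<longlonglongrightarrow> 0"
      using z by (intro tendsto_sandwich[OF _ _ tendsto_const lim] always_eventually allI dist z)
        (simp add: power_le_one)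
    moreover have "(\<lambda>n. \<phi> z ^ r n) \<longlonglongrightarrow> 0"
      using LIMSEQ_subseq_LIMSEQ[OF LIMSEQ_power_zero r, of "\<phi> z"] self_mapsD(2)[OF \<phi> z]
      by (simp add: o_def)
    then have "(\<lambda>n. (1 - (cmod z)\<^sup>2) * cmod (deriv (T (r n)) z - deriv l z))
        \<longlonglongrightarrow> (1 - (cmod z)\<^sup>2) * cmod (0 * (deriv \<phi> z * deriv g (\<phi> z) - deriv g z) - deriv l z)"
      unfolding dT[OF z] by (intro tendsto_intros)
    ultimately have "(1 - (cmod z)\<^sup>2) * cmod (deriv l z) = 0"
      using LIMSEQ_unique by fastforce
    then show ?thesis
      using one_minus_norm_square_pos[of z] z by simp
  qed
  have "\<forall>\<^sub>F n in sequentially. Bloch_dist (T (r n)) l < \<epsilon> / 2"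
    using order_tendstoD(2)[OF lim, of "\<epsilon> / 2"] \<epsilon> by simp
  then obtain n where n: "Bloch_dist (T (r n)) l < \<epsilon> / 2"
    by (auto simp: eventually_sequentially)
  have w: "cmod (\<phi> z) ^ r n * w z < \<epsilon> / 2" if z: "z \<in> \<bbbD>" for z
    using le_less_trans[OF dist[OF z] n]
    by (simp add: dT[OF z] dl[OF z] w_def norm_mult norm_power mult_ac)
  show ?thesis
  proof
    \<comment> \<open>On \<open>\<rho> < cmod (\<phi> z)\<close> the factor \<open>cmod (\<phi> z) ^ r n\<close> is at least \<open>1/2\<close>; the successor is there
       because \<open>r n\<close> may be \<open>0\<close>.\<close>
    show "root (Suc (r n)) (1 / 2) < 1"
      by simp
    fix z assume z: "z \<in> \<bbbD>" and \<rho>: "root (Suc (r n)) (1 / 2) < cmod (\<phi> z)"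
    have "1 / 2 = root (Suc (r n)) (1 / 2) ^ Suc (r n)"
      by (rule real_root_pow_pos2[symmetric]) auto
    also have "\<dots> \<le> cmod (\<phi> z) ^ Suc (r n)"
      using \<rho> by (intro power_mono) auto
    also have "\<dots> \<le> cmod (\<phi> z) ^ r n"
      using self_mapsD(2)[OF \<phi> z] by (intro power_decreasing) auto
    finally have "1 / 2 * w z \<le> cmod (\<phi> z) ^ r n * w z"
      using z by (intro mult_right_mono) (auto simp: w_def power_le_one)
    then show "(1 - (cmod z)\<^sup>2) * cmod (deriv \<phi> z * deriv g (\<phi> z) - deriv g z) < \<epsilon>"
      using w[OF z] by (simp add: w_def)
  qed
qed

section \<open>Averaging over rotations\<close>

lemma rotation_in_self_maps: "restrict (\<lambda>z. cis t * z) \<bbbD> \<in> self_maps"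
proof -
  have "restrict (\<lambda>z. cis t * z) \<bbbD> holomorphic_on \<bbbD>"
    by (rule holomorphic_transform[of "\<lambda>z. cis t * z"]) (auto intro!: holomorphic_intros)
  then show ?thesis
    by (auto simp: self_maps_def Hol_def norm_mult)
qed

lemma deriv_rotation:
  assumes "z \<in> \<bbbD>"
  shows "deriv (restrict (\<lambda>z. cis t * z) \<bbbD>) z = cis t"
proof (rule DERIV_imp_deriv)
  have "((\<lambda>z. cis t * z) has_field_derivative cis t) (at z)"
    by (auto intro!: derivative_eq_intros)
  then show "(restrict (\<lambda>z. cis t * z) \<bbbD> has_field_derivative cis t) (at z)"
    by (rule has_field_derivative_transform_within_open[OF _ open_ball assms]) auto
qed

text \<open>Up to the factor \<open>\<i> * z\<close> the integrand is the derivative of the periodic function \<open>g (cis t * z)\<close>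
of \<open>t\<close>.\<close>

lemma has_integral_rotated_deriv:
  assumes g: "g holomorphic_on \<bbbD>" and z: "z \<in> \<bbbD>" "z \<noteq> 0"
  shows "((\<lambda>t. cis t * deriv g (cis t * z)) has_integral 0) {0..2 * pi}"
proof -
  have "((\<lambda>t. \<i> * z * (cis t * deriv g (cis t * z))) has_integral
      g (cis (2 * pi) * z) - g (cis 0 * z)) {0..2 * pi}"
  proof (rule fundamental_theorem_of_calculus)
    fix t :: real
    have inside: "cis t * z \<in> \<bbbD>"
      using z by (simp add: norm_mult)
    have "((\<lambda>t. cis t * z) has_vector_derivative \<i> * cis t * z) (at t within {0..2 * pi})"
      unfolding has_vector_derivative_def
      by (auto intro!: derivative_eq_intros)
    then have "((g \<circ> (\<lambda>t. cis t * z)) has_vector_derivative \<i> * cis t * z * deriv g (cis t * z))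
        (at t within {0..2 * pi})"
      by (rule field_vector_diff_chain_within)
        (use holomorphic_derivI[OF g open_ball inside] in \<open>auto intro: has_field_derivative_at_within\<close>)
    then show "((\<lambda>t. g (cis t * z)) has_vector_derivative \<i> * z * (cis t * deriv g (cis t * z)))
        (at t within {0..2 * pi})"
      by (simp add: o_def mult_ac)
  qed simp
  then have "((\<lambda>t. \<i> * z * (cis t * deriv g (cis t * z))) has_integral 0) {0..2 * pi}"
    by simp
  from has_integral_mult_right[OF this, of "inverse (\<i> * z)"] show ?thesis
    using z(2) by (simp add: field_simps)
qed

text \<open>The decay need not be uniform in \<open>t\<close>: dominated convergence suffices to integrate it over \<open>t\<close>, which
removes the rotated term.\<close>

lemma little_Bloch_if_rotation_decay:
  assumes g: "g \<in> Bloch"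
    and decay: "\<And>t \<epsilon>. 0 < \<epsilon> \<Longrightarrow> \<exists>\<rho><1. \<forall>z\<in>\<bbbD>. \<rho> < cmod z \<longrightarrow>
      (1 - (cmod z)\<^sup>2) * cmod (cis t * deriv g (cis t * z) - deriv g z) < \<epsilon>"
  shows "g \<in> little_Bloch"
proof (rule ccontr)
  assume "g \<notin> little_Bloch"
  then obtain \<epsilon> where \<epsilon>: "\<epsilon> > 0"
    and far: "\<And>\<rho>. \<rho> < 1 \<Longrightarrow> \<exists>z. \<rho> < cmod z \<and> cmod z < 1 \<and> \<epsilon> \<le> bloch_weight g z"
    using g unfolding little_Bloch_iff by (meson not_le)
  have "\<forall>n. \<exists>z. 1 - 1 / real (Suc n) < cmod z \<and> cmod z < 1 \<and> \<epsilon> \<le> bloch_weight g z"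
    by (intro allI far) simp
  then obtain z where z: "\<And>n. 1 - 1 / real (Suc n) < cmod (z n)" "\<And>n. cmod (z n) < 1"
      "\<And>n. \<epsilon> \<le> bloch_weight g (z n)"
    by metis
  have z0: "z n \<noteq> 0" for n
    using z(1)[of n] by (auto simp: field_simps)
  have zlim: "(\<lambda>n. cmod (z n)) \<longlonglongrightarrow> 1"
  proof (rule tendsto_sandwich)
    show "(\<lambda>n. 1 - 1 / real (Suc n)) \<longlonglongrightarrow> 1"
      using tendsto_diff[OF tendsto_const LIMSEQ_inverse_real_of_nat, of 1] by (simp add: inverse_eq_divide)
  qed (use z in \<open>auto intro!: always_eventually less_imp_le\<close>)
  \<comment> \<open>The integral of \<open>F n\<close> over \<open>t\<close> recovers \<open>deriv g (z n)\<close>: the rotated term has mean zero.\<close>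
  define F where "F n t = of_real (1 - (cmod (z n))\<^sup>2) *
    (cis t * deriv g (cis t * z n) - deriv g (z n))" for n t
  have normF: "cmod (F n t) = (1 - (cmod (z n))\<^sup>2) *
      cmod (cis t * deriv g (cis t * z n) - deriv g (z n))" for n t
    using one_minus_norm_square_pos[OF z(2)[of n]]
    by (simp only: F_def norm_mult norm_of_real abs_of_pos)
  obtain G where G: "G > 0" "\<And>z. z \<in> \<bbbD> \<Longrightarrow> bloch_weight g z \<le> G"
    using Bloch_weight_bound[OF g] by blast
  have int: "(F n has_integral of_real (1 - (cmod (z n))\<^sup>2) * (0 - 2 * pi * deriv g (z n))) {0..2 * pi}" for n
    unfolding F_def
    using has_integral_rotated_deriv[OF BlochD(2)[OF g], of "z n"]
      has_integral_const_real[of "deriv g (z n)" 0 "2 * pi"] z(2)[of n] z0[of n]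
    by (intro has_integral_mult_right has_integral_diff) (auto simp: scaleR_conv_of_real)
  have "(\<lambda>n. integral {0..2 * pi} (F n)) \<longlonglongrightarrow> integral {0..2 * pi} (\<lambda>t. 0)"
  proof (rule dominated_convergence(2)[OF has_integral_integrable[OF int]])
    show "(\<lambda>t. 2 * G) integrable_on {0..2 * pi}"
      by (rule integrable_const_ivl)
    \<comment> \<open>Since a rotation preserves \<open>cmod z\<close>, both terms of \<open>F n t\<close> are bounded by a bound
       for the weight of \<open>g\<close>.\<close>
    show "norm (F n t) \<le> 2 * G" for n t
    proof -
      have "cmod (F n t) \<le> bloch_weight g (cis t * z n) + bloch_weight g (z n)"
        using commutator_weight_le[OF rotation_in_self_maps, of "z n" t g] z(2)[of n]
        by (simp add: normF deriv_rotation)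
      moreover have "bloch_weight g (cis t * z n) \<le> G" "bloch_weight g (z n) \<le> G"
        using z(2)[of n] by (auto intro!: G(2) simp: norm_mult)
      ultimately show ?thesis by simp
    qed
    show "(\<lambda>n. F n t) \<longlonglongrightarrow> 0" for t
    proof (rule tendstoI)
      fix e :: real assume "e > 0"
      then obtain \<rho> where \<rho>: "\<rho> < 1" "\<forall>z\<in>\<bbbD>. \<rho> < cmod z \<longrightarrow>
          (1 - (cmod z)\<^sup>2) * cmod (cis t * deriv g (cis t * z) - deriv g z) < e"
        using decay by blast
      from order_tendstoD(1)[OF zlim \<rho>(1)] show "\<forall>\<^sub>F n in sequentially. dist (F n t) 0 < e"
        by eventually_elim (use \<rho>(2) z(2) in \<open>simp add: normF\<close>)
    qed
  qed
  then have "(\<lambda>n. cmod (integral {0..2 * pi} (F n))) \<longlonglongrightarrow> 0"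
    by (simp add: tendsto_norm_zero)
  moreover have "cmod (integral {0..2 * pi} (F n)) = 2 * pi * bloch_weight g (z n)" for n
    using one_minus_norm_square_pos[OF z(2)[of n]]
    by (simp only: integral_unique[OF int] norm_mult diff_0 norm_minus_cancel norm_of_real abs_of_pos bloch_weight_def)
       (simp add: norm_mult)
  ultimately have "(\<lambda>n. bloch_weight g (z n)) \<longlonglongrightarrow> 0"
    by simp
  then have "\<epsilon> \<le> 0"
    using z(3) by (intro LIMSEQ_le_const) auto
  then show False
    using \<epsilon> by simp
qed

theorem theorem4p5:
  fixes g :: "complex \<Rightarrow> complex"
  assumes "g \<in> Bloch"
  shows "(\<forall>\<phi>\<in>self_maps. compact_operator Hinf_metric Bloch_metric (commutator_op \<phi> g))
    \<longleftrightarrow> g \<in> little_Bloch"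
proof
  assume cpt: "\<forall>\<phi>\<in>self_maps. compact_operator Hinf_metric Bloch_metric (commutator_op \<phi> g)"
  show "g \<in> little_Bloch"
  proof (rule little_Bloch_if_rotation_decay[OF assms])
    fix t \<epsilon> :: real assume "0 < \<epsilon>"
    let ?\<phi> = "restrict (\<lambda>z. cis t * z) \<bbbD>"
    obtain \<rho> where "\<rho> < 1" "\<And>z. z \<in> \<bbbD> \<Longrightarrow> \<rho> < cmod (?\<phi> z) \<Longrightarrow>
        (1 - (cmod z)\<^sup>2) * cmod (deriv ?\<phi> z * deriv g (?\<phi> z) - deriv g z) < \<epsilon>"
      by (rule compact_commutator_op_imp_weight_decay[OF assms rotation_in_self_maps
          bspec[OF cpt rotation_in_self_maps] \<open>0 < \<epsilon>\<close>]) (rule that)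
    then show "\<exists>\<rho><1. \<forall>z\<in>\<bbbD>. \<rho> < cmod z \<longrightarrow>
        (1 - (cmod z)\<^sup>2) * cmod (cis t * deriv g (cis t * z) - deriv g z) < \<epsilon>"
      by (intro exI[of _ \<rho>]) (auto simp: deriv_rotation norm_mult)
  qed
qed (use compact_operator_commutator_op in blast)

end
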